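(* Let $(X,\Sigma_X)$ be a measurable space, $p\ge 1$ an integer, $\mu$ a probability measure on $X$, and $Q,\overline{Q}:X\times\Sigma_X\to[0,1]$ Markov kernels. Define the Markov kernel $\mathcal{V}$ from $X$ to $X^p$ by $$\mathcal{V}(q_0,dq_1,\dots,dq_p)=\int_X\prod_{i=1}^p Q(q,dq_i)\,\overline{Q}(q_0,dq).$$ Let $S_0:=I$ and, for $j=1,\dots,p$, $S_j:X^{p+1}\to X^{p+1}$, $S_j(q_0,q_1,\dots,q_p)=(q_j,q_1,\dots,q_{j-1},q_0,q_{j+1},\dots,q_p)$. Suppose that $\mu\ll\mu_0$ for some $\sigma$-finite measure $\mu_0$ on $X$, with $\frac{d\mu}{d\mu_0}(q)>0$ for $\mu_0$-a.e. $q\in X$, and that $$Q(q,d\tilde q)\,\mu_0(dq)=\overline{Q}(\tilde q,dq)\,\mu_0(d\tilde q)$$ as measures on $X\times X$ (in the variables $(q,\tilde q)$). Let $\frac{d\mu}{d\mu_0}$ denote a fixed version of the density that is finite and strictly positive everywhere. For $(q_0,v)=(q_0,q_1,\dots,q_p)\in X\times X^p$ define either (a) $\displaystyle \alpha_j(q_0,v)=\frac{\frac{d\mu}{d\mu_0}(q_j)}{\sum_{k=0}^p\frac{d\mu}{d\mu_0}(q_k)}$ for $j=0,1,\dots,p$; or (b) $\displaystyle \alpha_j(q_0,v)=\overline{\alpha}_j\Big[1\wedge\frac{\frac{d\mu}{d\mu_0}(q_j)}{\frac{d\mu}{d\mu_0}(q_0)}\Big]$ for $j=1,\dots,p$, and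 $\alpha_0(q_0,v)=1-\sum_{j=1}^p\alpha_j(q_0,v)$, where $\overline{\alpha}_j\ge 0$ are weights with $\sum_{j=1}^p\overline{\alpha}_j\le 1$. Then in either case the Markov kernel $$P^{\alpha,S,\mathcal{V}}(q_0,d\tilde q)=\sum_{j=0}^p\int_{X^p}\alpha_j(q_0,v)\,\delta_{\Pi_1 S_j(q_0,v)}(d\tilde q)\,\mathcal{V}(q_0,dv)$$ satisfies detailed balance with respect to $\mu$, i.e. $P^{\alpha,S,\mathcal{V}}(q,d\tilde q)\,\mu(dq)=P^{\alpha,S,\mathcal{V}}(\tilde q,dq)\,\mu(d\tilde q)$ as measures on $X\times X$.
   Context: $X^p$ and $X^{p+1}$ carry the product $\sigma$-algebras. A Markov kernel $Q:X\times\Sigma_X\to[0,1]$ is a map such that $Q(q,\cdot)$ is a probability measure for each $q$ and $q\mapsto Q(q,E)$ is measurable for each $E\in\Sigma_X$. $\Pi_1(q_0,v)=q_0$ is the projection onto the first ($X$) component, so $\Pi_1S_j(q_0,v)=q_j$. $a\wedge b=\min(a,b)$. $d\mu/d\mu_0$ denotes the Radon–Nikodym derivative. *)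

theory Defs
  imports "HOL-Probability.Probability"
begin

text \<open>
  A measurable space \<open>(X, \<Sigma>\<^sub>X)\<close> is given by a measure \<open>M\<close> of which only \<open>space M\<close> and
  \<open>sets M\<close> are used.  A Markov kernel from \<open>M\<close> to \<open>N\<close> is a
  \<open>K \<in> M \<rightarrow>\<^sub>M prob_algebra N\<close>.
  Points of \<open>X\<^sup>p\<close> are points of \<open>\<Pi>\<^sub>M i\<in>{1..p}. M\<close>, points of \<open>X\<^sup>p\<^sup>+\<^sup>1\<close> are points of
  \<open>\<Pi>\<^sub>M i\<in>{0..p}. M\<close>, and the pair \<open>(q\<^sub>0, v)\<close> is the function \<open>v(0 := q\<^sub>0)\<close>.
\<close>

subsection \<open>The joint measure of a measure and a kernel\<close>

text \<open>The measure \<open>K(x, dy) \<nu>(dx)\<close> in the variables \<open>(x, y)\<close>.\<close>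

definition joint :: "'a measure \<Rightarrow> ('a \<Rightarrow> 'a measure) \<Rightarrow> ('a \<times> 'a) measure" where
  "joint \<nu> K = measure_of (space \<nu> \<times> space \<nu>) (sets (\<nu> \<Otimes>\<^sub>M \<nu>))
     (\<lambda>A. \<integral>\<^sup>+x. (\<integral>\<^sup>+y. indicator A (x, y) \<partial>K x) \<partial>\<nu>)"

text \<open>The measure \<open>K(y, dx) \<nu>(dy)\<close>, again in the variables \<open>(x, y)\<close>.\<close>

definition joint_swapped :: "'a measure \<Rightarrow> ('a \<Rightarrow> 'a measure) \<Rightarrow> ('a \<times> 'a) measure" where
  "joint_swapped \<nu> K = distr (joint \<nu> K) (\<nu> \<Otimes>\<^sub>M \<nu>) (\<lambda>(y, x). (x, y))"

definition detailed_balance :: "'a measure \<Rightarrow> ('a \<Rightarrow> 'a measure) \<Rightarrow> bool" where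
  "detailed_balance \<nu> K \<longleftrightarrow> joint \<nu> K = joint_swapped \<nu> K"

lemma sets_joint [simp, measurable_cong]: "sets (joint \<nu> K) = sets (\<nu> \<Otimes>\<^sub>M \<nu>)"
  unfolding joint_def space_pair_measure[symmetric] by (rule sets.sets_measure_of_eq)

lemma emeasure_joint:
  assumes K: "K \<in> \<nu> \<rightarrow>\<^sub>M prob_algebra \<nu>" and A: "A \<in> sets (\<nu> \<Otimes>\<^sub>M \<nu>)"
  shows "emeasure (joint \<nu> K) A = (\<integral>\<^sup>+x. (\<integral>\<^sup>+y. indicator A (x, y) \<partial>K x) \<partial>\<nu>)"
proof (rule emeasure_measure_of[OF joint_def])
  have K': "K \<in> \<nu> \<rightarrow>\<^sub>M subprob_algebra \<nu>" using K by (rule measurable_prob_algebraD)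
  have sK: "sets (K x) = sets \<nu>" if "x \<in> space \<nu>" for x
    using subprob_measurableD(2)[OF K' that] .
  show "countably_additive (sets (joint \<nu> K)) (\<lambda>A. \<integral>\<^sup>+x. (\<integral>\<^sup>+y. indicator A (x, y) \<partial>K x) \<partial>\<nu>)"
  proof (rule countably_additiveI)
    fix F :: "nat \<Rightarrow> ('a \<times> 'a) set"
    assume "range F \<subseteq> sets (joint \<nu> K)" and disj: "disjoint_family F"
    then have F [measurable]: "F i \<in> sets (\<nu> \<Otimes>\<^sub>M \<nu>)" for i by auto
    have "(\<Sum>i. \<integral>\<^sup>+x. (\<integral>\<^sup>+y. indicator (F i) (x, y) \<partial>K x) \<partial>\<nu>)
        = (\<integral>\<^sup>+x. (\<Sum>i. \<integral>\<^sup>+y. indicator (F i) (x, y) \<partial>K x) \<partial>\<nu>)"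
      by (intro nn_integral_suminf[symmetric] nn_integral_measurable_subprob_algebra2[OF _ K'])
        measurable
    also have "\<dots> = (\<integral>\<^sup>+x. (\<integral>\<^sup>+y. indicator (\<Union>i. F i) (x, y) \<partial>K x) \<partial>\<nu>)"
    proof (rule nn_integral_cong)
      fix x assume x: "x \<in> space \<nu>"
      note [measurable_cong] = sK[OF x]
      note [measurable] = x
      show "(\<Sum>i. \<integral>\<^sup>+y. indicator (F i) (x, y) \<partial>K x)
          = (\<integral>\<^sup>+y. indicator (\<Union>i. F i) (x, y) \<partial>K x)"
        by (subst nn_integral_suminf[symmetric])
          (auto intro!: nn_integral_cong simp: suminf_indicator[OF disj])
    qed
    finally show "(\<Sum>i. \<integral>\<^sup>+x. (\<integral>\<^sup>+y. indicator (F i) (x, y) \<partial>K x) \<partial>\<nu>)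
        = (\<integral>\<^sup>+x. (\<integral>\<^sup>+y. indicator (\<Union>i. F i) (x, y) \<partial>K x) \<partial>\<nu>)" .
  qed
next
  show "sets (\<nu> \<Otimes>\<^sub>M \<nu>) \<subseteq> Pow (space \<nu> \<times> space \<nu>)"
    unfolding space_pair_measure[symmetric] by (rule sets.space_closed)
  show "positive (sets (joint \<nu> K)) (\<lambda>A. \<integral>\<^sup>+x. (\<integral>\<^sup>+y. indicator A (x, y) \<partial>K x) \<partial>\<nu>)"
    by (simp add: positive_def)
  show "A \<in> sets (joint \<nu> K)" using A by simp
qed

subsection \<open>The proposal kernel\<close>

definition proposal_kernel ::
  "'a measure \<Rightarrow> nat \<Rightarrow> ('a \<Rightarrow> 'a measure) \<Rightarrow> ('a \<Rightarrow> 'a measure) \<Rightarrow> 'a \<Rightarrow> (nat \<Rightarrow> 'a) measure" where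
  "proposal_kernel M p Q Qbar q0 = Qbar q0 \<bind> (\<lambda>q. \<Pi>\<^sub>M i\<in>{1..p}. Q q)"

lemma measurable_PiM_kernel:
  assumes Q: "Q \<in> M \<rightarrow>\<^sub>M prob_algebra M" and I: "finite I"
  shows "(\<lambda>q. \<Pi>\<^sub>M i\<in>I. Q q) \<in> M \<rightarrow>\<^sub>M prob_algebra (\<Pi>\<^sub>M i\<in>I. M)"
proof (rule measurable_prob_algebra_generated[OF sets_PiM Int_stable_prod_algebra prod_algebra_sets_into_space])
  fix q assume q: "q \<in> space M"
  then have pq: "prob_space (Q q)" "sets (Q q) = sets M"
    using measurable_space[OF Q q] by (auto simp: space_prob_algebra)
  show "prob_space (\<Pi>\<^sub>M i\<in>I. Q q)" by (intro prob_space_PiM pq)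
  show "sets (\<Pi>\<^sub>M i\<in>I. Q q) = sets (\<Pi>\<^sub>M i\<in>I. M)" by (intro sets_PiM_cong refl pq)
next
  fix A assume "A \<in> prod_algebra I (\<lambda>i. M)"
  then obtain E where A: "A = Pi\<^sub>E I E" and E: "\<And>i. i \<in> I \<Longrightarrow> E i \<in> sets M"
    using I by (auto simp: prod_algebra_eq_finite)
  have "emeasure (\<Pi>\<^sub>M i\<in>I. Q q) A = (\<Prod>i\<in>I. emeasure (Q q) (E i))" if q: "q \<in> space M" for q
  proof -
    have pq: "prob_space (Q q)" "sets (Q q) = sets M"
      using measurable_space[OF Q q] by (auto simp: space_prob_algebra)
    interpret product_prob_space "\<lambda>i. Q q" I
      using pq by (simp add: product_prob_space_def product_prob_space_axioms_def
          product_sigma_finite_def prob_space_imp_sigma_finite)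
    show ?thesis unfolding A using E pq by (intro emeasure_PiM I) auto
  qed
  moreover have "(\<lambda>q. \<Prod>i\<in>I. emeasure (Q q) (E i)) \<in> borel_measurable M"
    by (intro borel_measurable_prod_ennreal
        measurable_compose[OF measurable_prob_algebraD[OF Q] measurable_emeasure_subprob_algebra] E)
  ultimately show "(\<lambda>q. emeasure (\<Pi>\<^sub>M i\<in>I. Q q) A) \<in> borel_measurable M"
    by (simp cong: measurable_cong)
qed

lemma proposal_kernel_markov:
  assumes "Q \<in> M \<rightarrow>\<^sub>M prob_algebra M" "Qbar \<in> M \<rightarrow>\<^sub>M prob_algebra M"
  shows "proposal_kernel M p Q Qbar \<in> M \<rightarrow>\<^sub>M prob_algebra (\<Pi>\<^sub>M i\<in>{1..p}. M)"
  unfolding proposal_kernel_def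
  by (rule measurable_bind_prob_space[OF assms(2) measurable_PiM_kernel[OF assms(1)]]) simp

subsection \<open>The multiple proposal kernel\<close>

definition proj_first :: "(nat \<Rightarrow> 'a) \<Rightarrow> 'a" where
  "proj_first z = z 0"

text \<open>For \<open>j = 0\<close> the following is the identity.\<close>

definition swap_first :: "nat \<Rightarrow> (nat \<Rightarrow> 'a) \<Rightarrow> (nat \<Rightarrow> 'a)" where
  "swap_first j z = z(0 := z j, j := z 0)"

lemma swap_first_0: "swap_first 0 = id"
  by (auto simp: swap_first_def fun_eq_iff)

text \<open>The Dirac measure \<open>\<delta>\<^sub>x\<close> on \<open>M\<close> is \<open>return M x\<close>.\<close>

definition mp_kernel ::
  "'a measure \<Rightarrow> nat \<Rightarrow> (nat \<Rightarrow> (nat \<Rightarrow> 'a) \<Rightarrow> real) \<Rightarrow> (nat \<Rightarrow> (nat \<Rightarrow> 'a) \<Rightarrow> (nat \<Rightarrow> 'a)) \<Rightarrow>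
    ('a \<Rightarrow> (nat \<Rightarrow> 'a) measure) \<Rightarrow> 'a \<Rightarrow> 'a measure" where
  "mp_kernel M p \<alpha> T V q0 = measure_of (space M) (sets M)
     (\<lambda>A. \<Sum>j=0..p. \<integral>\<^sup>+v. ennreal (\<alpha> j (v(0 := q0)))
        * emeasure (return M (proj_first (T j (v(0 := q0))))) A \<partial>V q0)"

text \<open>In both acceptance rules \<open>r\<close> is the chosen version of \<open>d\<mu>/d\<mu>\<^sub>0\<close>.\<close>

definition alpha_a :: "nat \<Rightarrow> ('a \<Rightarrow> real) \<Rightarrow> nat \<Rightarrow> (nat \<Rightarrow> 'a) \<Rightarrow> real" where
  "alpha_a p r j z = r (z j) / (\<Sum>k=0..p. r (z k))"

definition alpha_b :: "nat \<Rightarrow> (nat \<Rightarrow> real) \<Rightarrow> ('a \<Rightarrow> real) \<Rightarrow> nat \<Rightarrow> (nat \<Rightarrow> 'a) \<Rightarrow> real" where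
  "alpha_b p w r j z =
     (if j = 0 then 1 - (\<Sum>i=1..p. w i * min 1 (r (z i) / r (z 0)))
      else w j * min 1 (r (z j) / r (z 0)))"

end

theory Submission
  imports Defs
begin

text \<open>
  Disintegrate \<open>\<V>\<close> over the auxiliary point \<open>q\<close>.  The duality of \<open>Q\<close> and \<open>Qbar\<close> with respect
  to \<open>\<mu>\<^sub>0\<close> turns \<open>\<V>(q\<^sub>0, dv) \<mu>\<^sub>0(dq\<^sub>0)\<close> into the mixture \<open>\<integral> \<Prod>\<^sub>i Q(q, dq\<^sub>i) \<mu>\<^sub>0(dq)\<close> over \<open>i = 0, \<dots>, p\<close>,
  which is exchangeable, hence invariant under every \<open>S\<^sub>j\<close>.  Writing \<open>r\<close> for the density of \<open>\<mu>\<close>,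
  detailed balance then reduces to the pointwise identity
  \<open>r(q\<^sub>0) \<alpha>\<^sub>j(z) = r(q\<^sub>j) \<alpha>\<^sub>j(S\<^sub>j z)\<close>, which holds for both choices of \<open>\<alpha>\<close>.
\<close>

section \<open>Integration against joint measures\<close>

text \<open>The joint measure is a \<open>bind\<close> of \<open>\<nu>\<close> with the kernel that
  sends \<open>x\<close> to the product of the Dirac mass at \<open>x\<close> with
  \<open>K x\<close>. The integral formula for \<open>bind\<close> then yields the iterated
  integral.\<close>

lemma nn_integral_joint:
  assumes K: "K \<in> \<nu> \<rightarrow>\<^sub>M prob_algebra \<nu>"
    and f [measurable]: "f \<in> borel_measurable (\<nu> \<Otimes>\<^sub>M \<nu>)"
  shows "integral\<^sup>N (joint \<nu> K) f = (\<integral>\<^sup>+x. \<integral>\<^sup>+y. f (x, y) \<partial>K x \<partial>\<nu>)"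
proof (cases "space \<nu> = {}")
  \<comment> \<open>The rules for \<open>bind\<close> require a nonempty space. On an empty space
    both integrals vanish.\<close>
  case True
  then have "space (joint \<nu> K) = {}"
    using sets_eq_imp_space_eq[OF sets_joint, of \<nu> K] by (simp add: space_pair_measure)
  with True show ?thesis by (simp add: nn_integral_empty)
next
  case False
  \<comment> \<open>\<open>L x\<close> is \<open>K x\<close> placed on the slice over
    \<open>x\<close>.\<close>
  define L where "L = (\<lambda>x. distr (K x) (\<nu> \<Otimes>\<^sub>M \<nu>) (Pair x))"
  have K' [measurable]: "K \<in> \<nu> \<rightarrow>\<^sub>M subprob_algebra \<nu>" using K by (rule measurable_prob_algebraD)
  have sK: "sets (K x) = sets \<nu>" if "x \<in> space \<nu>" for x
    using subprob_measurableD(2)[OF K' that] .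
  have L: "L \<in> \<nu> \<rightarrow>\<^sub>M subprob_algebra (\<nu> \<Otimes>\<^sub>M \<nu>)"
    unfolding L_def by (rule measurable_distr2[OF _ K']) simp
  have int_L: "integral\<^sup>N (L x) g = (\<integral>\<^sup>+y. g (x, y) \<partial>K x)"
    if x: "x \<in> space \<nu>" and g: "g \<in> borel_measurable (\<nu> \<Otimes>\<^sub>M \<nu>)" for x g
    unfolding L_def using x g sK[OF x]
    by (subst nn_integral_distr) (simp_all cong: measurable_cong_sets)
  have "joint \<nu> K = \<nu> \<bind> L"
  proof (rule measure_eqI)
    show "sets (joint \<nu> K) = sets (\<nu> \<bind> L)"
      using False by (subst sets_bind[OF subprob_measurableD(2)[OF L]]) simp_all
  next
    fix A assume "A \<in> sets (joint \<nu> K)"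
    then have A: "A \<in> sets (\<nu> \<Otimes>\<^sub>M \<nu>)" by simp
    have "emeasure (\<nu> \<bind> L) A = (\<integral>\<^sup>+x. emeasure (L x) A \<partial>\<nu>)"
      by (rule emeasure_bind[OF False L A])
    also have "\<dots> = (\<integral>\<^sup>+x. (\<integral>\<^sup>+y. indicator A (x, y) \<partial>K x) \<partial>\<nu>)"
    proof (rule nn_integral_cong)
      fix x assume x: "x \<in> space \<nu>"
      have "emeasure (L x) A = integral\<^sup>N (L x) (indicator A)"
        using A by (intro nn_integral_indicator[symmetric]) (simp add: L_def)
      also have "\<dots> = (\<integral>\<^sup>+y. indicator A (x, y) \<partial>K x)"
        using A by (intro int_L x) simp
      finally show "emeasure (L x) A = (\<integral>\<^sup>+y. indicator A (x, y) \<partial>K x)" .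
    qed
    finally show "emeasure (joint \<nu> K) A = emeasure (\<nu> \<bind> L) A"
      using emeasure_joint[OF K A] by simp
  qed
  then have "integral\<^sup>N (joint \<nu> K) f = (\<integral>\<^sup>+x. integral\<^sup>N (L x) f \<partial>\<nu>)"
    by (simp add: nn_integral_bind[OF f L])
  also have "\<dots> = (\<integral>\<^sup>+x. \<integral>\<^sup>+y. f (x, y) \<partial>K x \<partial>\<nu>)"
    by (intro nn_integral_cong int_L f)
  finally show ?thesis .
qed

lemma nn_integral_joint_swapped:
  assumes K: "K \<in> \<nu> \<rightarrow>\<^sub>M prob_algebra \<nu>"
    and f [measurable]: "f \<in> borel_measurable (\<nu> \<Otimes>\<^sub>M \<nu>)"
  shows "integral\<^sup>N (joint_swapped \<nu> K) f = (\<integral>\<^sup>+y. \<integral>\<^sup>+x. f (x, y) \<partial>K y \<partial>\<nu>)"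
proof -
  have "integral\<^sup>N (joint_swapped \<nu> K) f = (\<integral>\<^sup>+z. f (case z of (y, x) \<Rightarrow> (x, y)) \<partial>joint \<nu> K)"
    unfolding joint_swapped_def by (subst nn_integral_distr) simp_all
  also have "\<dots> = (\<integral>\<^sup>+y. \<integral>\<^sup>+x. f (x, y) \<partial>K y \<partial>\<nu>)"
    by (subst nn_integral_joint[OF K]) simp_all
  finally show ?thesis .
qed

lemma emeasure_joint_swapped:
  assumes K: "K \<in> \<nu> \<rightarrow>\<^sub>M prob_algebra \<nu>" and A [measurable]: "A \<in> sets (\<nu> \<Otimes>\<^sub>M \<nu>)"
  shows "emeasure (joint_swapped \<nu> K) A = (\<integral>\<^sup>+y. \<integral>\<^sup>+x. indicator A (x, y) \<partial>K y \<partial>\<nu>)"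
proof -
  have "emeasure (joint_swapped \<nu> K) A = integral\<^sup>N (joint_swapped \<nu> K) (indicator A)"
    by (intro nn_integral_indicator[symmetric]) (simp add: joint_swapped_def A)
  then show ?thesis by (simp add: nn_integral_joint_swapped[OF K])
qed

section \<open>The swaps \<open>S_j\<close> and exchangeability of i.i.d. products\<close>

lemma proj_swap_first: "proj_first (swap_first j z) = z j"
  by (simp add: proj_first_def swap_first_def)

text \<open>As a reindexing of coordinates by a transposition, the swap is within reach of the
  general facts on reindexed products. Extensionality of \<open>z\<close> settles the indices
  outside \<open>I\<close>, where both sides are \<open>undefined\<close>.\<close>

lemma swap_first_eq_transpose:
  assumes "z \<in> extensional I" "0 \<in> I" "j \<in> I"
  shows "swap_first j z = (\<lambda>i\<in>I. z (Transposition.transpose 0 j i))"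
  using assms by (auto simp: swap_first_def fun_eq_iff Transposition.transpose_def extensional_def)

lemma measurable_swap_first [measurable]:
  assumes "0 \<in> I" "j \<in> I"
  shows "swap_first j \<in> (\<Pi>\<^sub>M i\<in>I. M) \<rightarrow>\<^sub>M (\<Pi>\<^sub>M i\<in>I. M)"
proof -
  have "swap_first j \<in> (\<Pi>\<^sub>M i\<in>I. M) \<rightarrow>\<^sub>M (\<Pi>\<^sub>M i\<in>I. M) \<longleftrightarrow>
      (\<lambda>z. \<lambda>i\<in>I. z (Transposition.transpose 0 j i)) \<in> (\<Pi>\<^sub>M i\<in>I. M) \<rightarrow>\<^sub>M (\<Pi>\<^sub>M i\<in>I. M)"
    by (rule measurable_cong)
      (rule swap_first_eq_transpose[OF _ assms], simp add: space_PiM PiE_iff)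
  moreover have "Transposition.transpose 0 j i \<in> I" if "i \<in> I" for i
    using assms that by (simp add: Transposition.transpose_def)
  ultimately show ?thesis by (auto intro!: measurable_restrict measurable_component_singleton)
qed

text \<open>Exchangeability: all factors equal \<open>N\<close>, and a transposition is an injective
  map of \<open>I\<close> into itself, so reindexing by it pushes the product measure forward to
  itself.\<close>

lemma nn_integral_PiM_swap_first:
  assumes N: "prob_space N" and I: "0 \<in> I" "j \<in> I"
    and f: "f \<in> borel_measurable (\<Pi>\<^sub>M i\<in>I. N)"
  shows "(\<integral>\<^sup>+z. f (swap_first j z) \<partial>(\<Pi>\<^sub>M i\<in>I. N)) = (\<integral>\<^sup>+z. f z \<partial>(\<Pi>\<^sub>M i\<in>I. N))"
proof -
  have "distr (\<Pi>\<^sub>M i\<in>I. N) (\<Pi>\<^sub>M i\<in>I. N) (swap_first j)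
      = distr (\<Pi>\<^sub>M i\<in>I. N) (\<Pi>\<^sub>M i\<in>I. N) (\<lambda>z. \<lambda>i\<in>I. z (Transposition.transpose 0 j i))"
    by (rule distr_cong[OF refl refl])
      (rule swap_first_eq_transpose[OF _ I], simp add: space_PiM PiE_iff)
  also have "\<dots> = (\<Pi>\<^sub>M i\<in>I. N)"
    by (rule distr_PiM_reindex) (use N I in \<open>auto simp: Transposition.transpose_def inj_on_def split: if_splits\<close>)
  finally have "(\<integral>\<^sup>+z. f z \<partial>(\<Pi>\<^sub>M i\<in>I. N))
      = (\<integral>\<^sup>+z. f z \<partial>distr (\<Pi>\<^sub>M i\<in>I. N) (\<Pi>\<^sub>M i\<in>I. N) (swap_first j))" by simp
  also have "\<dots> = (\<integral>\<^sup>+z. f (swap_first j z) \<partial>(\<Pi>\<^sub>M i\<in>I. N))"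
    using f by (intro nn_integral_distr measurable_swap_first I) simp
  finally show ?thesis ..
qed

section \<open>The proposal kernel as an exchangeable mixture\<close>

text \<open>This map identifies the pair of \<open>q0\<close> and \<open>v\<close> with a point of
  the larger product. Index 0 is free in \<open>{1..p}\<close>, so it adds a coordinate to a
  product, up to the order of the pair.\<close>

lemma measurable_fun_upd_0 [measurable]:
  fixes M :: "'a measure"
  shows "(\<lambda>(x, v). v(0 := x)) \<in> M \<Otimes>\<^sub>M (\<Pi>\<^sub>M i\<in>{1..p}. M) \<rightarrow>\<^sub>M (\<Pi>\<^sub>M i\<in>{0..p::nat}. M)"
proof -
  have "(\<lambda>(x::'a, v). v(0 := x)) = (\<lambda>(v, x). v(0::nat := x)) \<circ> (\<lambda>(x, v). (v, x))" by auto
  moreover have "(\<lambda>(v, x). v(0 := x)) \<circ> (\<lambda>(x, v). (v, x))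
      \<in> M \<Otimes>\<^sub>M (\<Pi>\<^sub>M i\<in>{1..p}. M) \<rightarrow>\<^sub>M (\<Pi>\<^sub>M i\<in>insert 0 {1..p}. M)"
    by (rule measurable_comp[OF measurable_pair_swap' measurable_add_dim])
  moreover have "insert 0 {1..p} = {0..p}" by auto
  ultimately show ?thesis by (simp only:)
qed

text \<open>The kernel draws an auxiliary point \<open>q\<close> from \<open>Qbar x\<close> and then
  \<open>p\<close> independent points from \<open>Q q\<close>. Duality turns drawing
  \<open>q\<close> from \<open>x\<close> into drawing \<open>x\<close> from \<open>q\<close>, so the
  start becomes one more independent draw from \<open>Q q\<close>, stored at index 0.\<close>

lemma nn_integral_proposal_kernel:
  assumes Q: "Q \<in> M \<rightarrow>\<^sub>M prob_algebra M" and Qbar: "Qbar \<in> M \<rightarrow>\<^sub>M prob_algebra M"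
    and m: "sets m = sets M" and dual: "joint m Q = joint_swapped m Qbar"
    and f [measurable]: "f \<in> borel_measurable (\<Pi>\<^sub>M i\<in>{0..p}. M)"
  shows "(\<integral>\<^sup>+x. \<integral>\<^sup>+v. f (v(0 := x)) \<partial>proposal_kernel M p Q Qbar x \<partial>m)
    = (\<integral>\<^sup>+q. \<integral>\<^sup>+z. f z \<partial>(\<Pi>\<^sub>M i\<in>{0..p}. Q q) \<partial>m)"
proof -
  have sp: "space m = space M" using m by (rule sets_eq_imp_space_eq)
  \<comment> \<open>\<open>prob_algebra\<close> depends only on the \<sigma>-algebra, so kernels on
    \<open>M\<close> are kernels on \<open>m\<close>.\<close>
  have "prob_algebra m = prob_algebra M"
    unfolding prob_algebra_def by (simp add: subprob_algebra_cong[OF m])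
  then have Qm: "Q \<in> m \<rightarrow>\<^sub>M prob_algebra m" "Qbar \<in> m \<rightarrow>\<^sub>M prob_algebra m"
    using Q Qbar m by (simp_all cong: measurable_cong_sets)
  have PQ: "(\<lambda>q. \<Pi>\<^sub>M i\<in>{1..p}. Q q) \<in> M \<rightarrow>\<^sub>M subprob_algebra (\<Pi>\<^sub>M i\<in>{1..p}. M)"
    by (intro measurable_prob_algebraD measurable_PiM_kernel Q) simp
  \<comment> \<open>The expectation over the proposals for a fixed auxiliary point \<open>q\<close>
    and start \<open>x\<close>. The argument \<open>q\<close> comes first to match the variable
    order in \<open>dual\<close>.\<close>
  define H where "H = (\<lambda>(q, x). \<integral>\<^sup>+v. f (v(0 := x)) \<partial>(\<Pi>\<^sub>M i\<in>{1..p}. Q q))"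
  have H: "H \<in> borel_measurable (M \<Otimes>\<^sub>M M)"
    unfolding H_def case_prod_unfold
    by (rule nn_integral_measurable_subprob_algebra2[where N = "\<Pi>\<^sub>M i\<in>{1..p}. M"])
      (measurable, rule measurable_compose[OF measurable_fst PQ])
  have upd: "(\<lambda>v. f (v(0 := x))) \<in> borel_measurable (\<Pi>\<^sub>M i\<in>{1..p}. M)" if "x \<in> space M" for x
    using measurable_compose[OF measurable_Pair1'[OF that] measurable_compose[OF measurable_fun_upd_0 f]]
    by simp
  have "(\<integral>\<^sup>+v. f (v(0 := x)) \<partial>proposal_kernel M p Q Qbar x) = (\<integral>\<^sup>+q. H (q, x) \<partial>Qbar x)"
    if x: "x \<in> space M" for x
  proof -
    have "sets (Qbar x) = sets M"
      using measurable_space[OF Qbar x] by (simp add: space_prob_algebra)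
    then show ?thesis
      unfolding proposal_kernel_def H_def prod.case
      using PQ by (intro nn_integral_bind[OF upd[OF x]]) (simp cong: measurable_cong_sets)
  qed
  then have "(\<integral>\<^sup>+x. \<integral>\<^sup>+v. f (v(0 := x)) \<partial>proposal_kernel M p Q Qbar x \<partial>m)
      = (\<integral>\<^sup>+x. \<integral>\<^sup>+q. H (q, x) \<partial>Qbar x \<partial>m)"
    by (intro nn_integral_cong) (simp add: sp)
  also have "\<dots> = integral\<^sup>N (joint_swapped m Qbar) H"
    using H by (intro nn_integral_joint_swapped[symmetric] Qm) (simp add: m cong: measurable_cong_sets sets_pair_measure_cong)
  also have "\<dots> = integral\<^sup>N (joint m Q) H" by (simp add: dual)
  also have "\<dots> = (\<integral>\<^sup>+q. \<integral>\<^sup>+x. H (q, x) \<partial>Q q \<partial>m)"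
    using H by (intro nn_integral_joint Qm) (simp add: m cong: measurable_cong_sets sets_pair_measure_cong)
  also have "\<dots> = (\<integral>\<^sup>+q. \<integral>\<^sup>+z. f z \<partial>(\<Pi>\<^sub>M i\<in>{0..p}. Q q) \<partial>m)"
  proof (rule nn_integral_cong)
    fix q assume "q \<in> space m"
    then have pq: "prob_space (Q q)" "sets (Q q) = sets M"
      using measurable_space[OF Q] by (auto simp: sp space_prob_algebra)
    interpret product_sigma_finite "\<lambda>i. Q q"
      using pq by (simp add: product_sigma_finite_def prob_space_imp_sigma_finite)
    have I: "insert 0 {1..p} = {0..p}" by auto
    have "sets (\<Pi>\<^sub>M i\<in>{0..p}. Q q) = sets (\<Pi>\<^sub>M i\<in>{0..p}. M)"
      by (intro sets_PiM_cong refl pq)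
    then have "f \<in> borel_measurable (\<Pi>\<^sub>M i\<in>insert 0 {1..p}. Q q)"
      unfolding I using f by (simp cong: measurable_cong_sets)
    \<comment> \<open>Tonelli: the integration over \<open>x\<close> under \<open>Q q\<close> is the
      factor at index 0 of the product over \<open>{0..p}\<close>.\<close>
    from product_nn_integral_insert_rev[OF _ _ this]
    show "(\<integral>\<^sup>+x. H (q, x) \<partial>Q q) = (\<integral>\<^sup>+z. f z \<partial>(\<Pi>\<^sub>M i\<in>{0..p}. Q q))"
      by (simp only: H_def I prod.case finite_atLeastAtMost atLeastAtMost_iff not_one_le_zero simp_thms)
  qed
  finally show ?thesis .
qed

section \<open>The Markov property of multiple proposal kernels\<close>

lemma sets_mp_kernel: "sets (mp_kernel M p \<alpha> T V x) = sets M"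
  unfolding mp_kernel_def by (rule sets.sets_measure_of_eq)

context
  fixes M :: "'a measure" and p :: nat
    and \<alpha> :: "nat \<Rightarrow> (nat \<Rightarrow> 'a) \<Rightarrow> real" and T :: "nat \<Rightarrow> (nat \<Rightarrow> 'a) \<Rightarrow> (nat \<Rightarrow> 'a)"
    and V :: "'a \<Rightarrow> (nat \<Rightarrow> 'a) measure"
  assumes V: "V \<in> M \<rightarrow>\<^sub>M prob_algebra (\<Pi>\<^sub>M i\<in>{1..p}. M)"
    and T: "\<And>j. j \<in> {0..p} \<Longrightarrow> T j \<in> (\<Pi>\<^sub>M i\<in>{0..p}. M) \<rightarrow>\<^sub>M (\<Pi>\<^sub>M i\<in>{0..p}. M)"
    and \<alpha>: "\<And>j. j \<in> {0..p} \<Longrightarrow> \<alpha> j \<in> borel_measurable (\<Pi>\<^sub>M i\<in>{0..p}. M)"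
begin

lemma measurable_proj_T:
  assumes j: "j \<in> {0..p}"
  shows "(\<lambda>z. proj_first (T j z)) \<in> (\<Pi>\<^sub>M i\<in>{0..p}. M) \<rightarrow>\<^sub>M M"
  unfolding proj_first_def
  by (rule measurable_compose[OF T[OF j] measurable_component_singleton]) simp

lemma sets_V: "x \<in> space M \<Longrightarrow> sets (V x) = sets (\<Pi>\<^sub>M i\<in>{1..p}. M)"
  using measurable_space[OF V] by (simp add: space_prob_algebra)

lemma measurable_section_V:
  assumes x: "x \<in> space M" and f: "f \<in> borel_measurable (\<Pi>\<^sub>M i\<in>{0..p}. M)"
  shows "(\<lambda>v. f (v(0 := x))) \<in> borel_measurable (V x)"
  using measurable_compose[OF measurable_Pair1'[OF x] measurable_compose[OF measurable_fun_upd_0 f]]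
  by (simp add: sets_V[OF x] cong: measurable_cong_sets)

lemma space_upd_V:
  assumes "x \<in> space M" "v \<in> space (V x)"
  shows "v(0 := x) \<in> space (\<Pi>\<^sub>M i\<in>{0..p}. M)"
  using measurable_space[OF measurable_fun_upd_0[of M p], of "(x, v)"] assms
    sets_eq_imp_space_eq[OF sets_V] by (simp add: space_pair_measure)

lemma borel_measurable_mp_integrand:
  assumes j: "j \<in> {0..p}" and g: "g \<in> borel_measurable M"
  shows "(\<lambda>z. ennreal (\<alpha> j z) * g (proj_first (T j z))) \<in> borel_measurable (\<Pi>\<^sub>M i\<in>{0..p}. M)"
  using \<alpha>[OF j] measurable_compose[OF measurable_proj_T[OF j] g] by measurable

text \<open>The kernel is given through \<open>measure_of\<close>, so its values are known only once
  the set function is shown to be countably additive. This holds because series of nonnegative terms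
  commute with the integrals and with the finite sum over \<open>j\<close>.\<close>

lemma emeasure_mp_kernel:
  assumes x: "x \<in> space M" and A: "A \<in> sets M"
  shows "emeasure (mp_kernel M p \<alpha> T V x) A
    = (\<Sum>j=0..p. \<integral>\<^sup>+v. ennreal (\<alpha> j (v(0 := x))) * indicator A (proj_first (T j (v(0 := x)))) \<partial>V x)"
proof -
  have "emeasure (mp_kernel M p \<alpha> T V x) A
      = (\<Sum>j=0..p. \<integral>\<^sup>+v. ennreal (\<alpha> j (v(0 := x))) * emeasure (return M (proj_first (T j (v(0 := x))))) A \<partial>V x)"
  proof (rule emeasure_measure_of[OF mp_kernel_def])
    show "sets M \<subseteq> Pow (space M)" by (rule sets.space_closed)
    show "A \<in> sets (mp_kernel M p \<alpha> T V x)" using A by (simp add: sets_mp_kernel)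
    show "positive (sets (mp_kernel M p \<alpha> T V x)) (\<lambda>A. \<Sum>j=0..p. \<integral>\<^sup>+v. ennreal (\<alpha> j (v(0 := x)))
        * emeasure (return M (proj_first (T j (v(0 := x))))) A \<partial>V x)"
      by (simp add: positive_def)
    show "countably_additive (sets (mp_kernel M p \<alpha> T V x)) (\<lambda>A. \<Sum>j=0..p. \<integral>\<^sup>+v. ennreal (\<alpha> j (v(0 := x)))
        * emeasure (return M (proj_first (T j (v(0 := x))))) A \<partial>V x)"
    proof (rule countably_additiveI)
      fix F :: "nat \<Rightarrow> 'a set"
      assume F: "range F \<subseteq> sets (mp_kernel M p \<alpha> T V x)" and disj: "disjoint_family F"
      let ?g = "\<lambda>A j v. ennreal (\<alpha> j (v(0 := x))) * emeasure (return M (proj_first (T j (v(0 := x))))) A"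
      have F': "F i \<in> sets M" for i using F by (auto simp: sets_mp_kernel)
      \<comment> \<open>On a measurable set the Dirac mass is an indicator, so the integrand is a
        section of a measurable function on the full product.\<close>
      have meas: "?g (F i) j \<in> borel_measurable (V x)" if j: "j \<in> {0..p}" for i j
        using measurable_section_V[OF x borel_measurable_mp_integrand[OF j, of "indicator (F i)"]] F'
        by simp
      have "(\<Sum>i. \<Sum>j=0..p. \<integral>\<^sup>+v. ?g (F i) j v \<partial>V x) = (\<Sum>j=0..p. \<Sum>i. \<integral>\<^sup>+v. ?g (F i) j v \<partial>V x)"
        by (intro suminf_sum) simp
      also have "\<dots> = (\<Sum>j=0..p. \<integral>\<^sup>+v. (\<Sum>i. ?g (F i) j v) \<partial>V x)"
        by (intro sum.cong refl nn_integral_suminf[symmetric] meas)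
      also have "\<dots> = (\<Sum>j=0..p. \<integral>\<^sup>+v. ?g (\<Union>i. F i) j v \<partial>V x)"
        using F' by (intro sum.cong refl nn_integral_cong)
          (simp add: suminf_indicator disj image_subset_iff)
      finally show "(\<Sum>i. \<Sum>j=0..p. \<integral>\<^sup>+v. ?g (F i) j v \<partial>V x)
          = (\<Sum>j=0..p. \<integral>\<^sup>+v. ?g (\<Union>i. F i) j v \<partial>V x)" .
    qed
  qed
  with A show ?thesis by simp
qed

text \<open>Every \<open>T j\<close> keeps points inside the space, so the total mass at
  \<open>x\<close> is the integral of the sum of the weights, which is 1, against the probability
  measure \<open>V x\<close>.\<close>

lemma mp_kernel_markov:
  assumes nonneg: "\<And>j z. \<lbrakk>j \<in> {0..p}; z \<in> space (\<Pi>\<^sub>M i\<in>{0..p}. M)\<rbrakk> \<Longrightarrow> 0 \<le> \<alpha> j z"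
    and sum_1: "\<And>z. z \<in> space (\<Pi>\<^sub>M i\<in>{0..p}. M) \<Longrightarrow> (\<Sum>j=0..p. \<alpha> j z) = 1"
  shows "mp_kernel M p \<alpha> T V \<in> M \<rightarrow>\<^sub>M prob_algebra M"
proof (rule measurable_prob_algebraI[OF _ measurable_subprob_algebra])
  fix x assume x: "x \<in> space M"
  have sp: "space (mp_kernel M p \<alpha> T V x) = space M"
    by (rule sets_eq_imp_space_eq[OF sets_mp_kernel])
  interpret Vx: prob_space "V x"
    using measurable_space[OF V x] by (simp add: space_prob_algebra)
  have "emeasure (mp_kernel M p \<alpha> T V x) (space M)
      = (\<Sum>j=0..p. \<integral>\<^sup>+v. ennreal (\<alpha> j (v(0 := x))) \<partial>V x)"
    unfolding emeasure_mp_kernel[OF x sets.top]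
    by (intro sum.cong refl nn_integral_cong)
      (simp add: measurable_space[OF measurable_proj_T space_upd_V[OF x]])
  also have "\<dots> = (\<integral>\<^sup>+v. (\<Sum>j=0..p. ennreal (\<alpha> j (v(0 := x)))) \<partial>V x)"
    by (intro nn_integral_sum[symmetric] measurable_section_V[OF x, of "\<lambda>z. ennreal (\<alpha> _ z)"]
        measurable_compose[OF \<alpha> measurable_ennreal])
  also have "\<dots> = (\<integral>\<^sup>+v. 1 \<partial>V x)"
  proof (rule nn_integral_cong)
    fix v assume "v \<in> space (V x)"
    then have z: "v(0 := x) \<in> space (\<Pi>\<^sub>M i\<in>{0..p}. M)" by (rule space_upd_V[OF x])
    \<comment> \<open>\<open>ennreal\<close> truncates negative reals to 0; nonnegativity of the
      weights lets the sum pass through it.\<close>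
    show "(\<Sum>j=0..p. ennreal (\<alpha> j (v(0 := x)))) = 1"
      by (subst sum_ennreal) (simp_all only: nonneg z sum_1 ennreal_1)
  qed
  finally show pr: "prob_space (mp_kernel M p \<alpha> T V x)"
    by (intro prob_spaceI) (simp add: sp Vx.emeasure_space_1)
  then show "subprob_space (mp_kernel M p \<alpha> T V x)" by (rule prob_space_imp_subprob_space)
  show "sets (mp_kernel M p \<alpha> T V x) = sets M" by (rule sets_mp_kernel)
next
  fix A assume A: "A \<in> sets M"
  \<comment> \<open>Here \<open>x\<close> enters both the integrand and the measure
    \<open>V x\<close>; joint measurability in \<open>x\<close> and \<open>v\<close> covers both
    dependences.\<close>
  have "(\<lambda>x. \<integral>\<^sup>+v. ennreal (\<alpha> j (v(0 := x))) * indicator A (proj_first (T j (v(0 := x)))) \<partial>V x)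
      \<in> borel_measurable M" if j: "j \<in> {0..p}" for j
    using measurable_compose[OF measurable_fun_upd_0 borel_measurable_mp_integrand[OF j, of "indicator A"]] A
    by (intro nn_integral_measurable_subprob_algebra2[OF _ measurable_prob_algebraD[OF V]])
      (simp add: case_prod_unfold)
  then have "(\<lambda>x. \<Sum>j=0..p. \<integral>\<^sup>+v. ennreal (\<alpha> j (v(0 := x))) * indicator A (proj_first (T j (v(0 := x)))) \<partial>V x)
      \<in> borel_measurable M"
    by (rule borel_measurable_sum)
  then show "(\<lambda>x. emeasure (mp_kernel M p \<alpha> T V x) A) \<in> borel_measurable M"
    by (simp add: emeasure_mp_kernel[OF _ A] cong: measurable_cong)
qed

end

section \<open>Detailed balance from a pointwise identity\<close>

text \<open>The mass that \<open>P\<close> carries along \<open>A\<close> is a sum over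
  \<open>j\<close> of integrals under the exchangeable mixture. Applying \<open>S_j\<close> inside
  the \<open>j\<close>-th integral exchanges start and destination, and \<open>balance\<close> says
  that the weight is unchanged by this, so the mass along \<open>A\<close> equals the mass along the
  reversal of \<open>A\<close>.\<close>

lemma detailed_balance_mp_kernel:
  assumes Q: "Q \<in> M \<rightarrow>\<^sub>M prob_algebra M" and Qbar: "Qbar \<in> M \<rightarrow>\<^sub>M prob_algebra M"
    and m: "sets m = sets M" and dual: "joint m Q = joint_swapped m Qbar"
    and \<mu>: "\<mu> = density m g" and g: "g \<in> borel_measurable M"
    and \<alpha>: "\<And>j. j \<in> {0..p} \<Longrightarrow> \<alpha> j \<in> borel_measurable (\<Pi>\<^sub>M i\<in>{0..p}. M)"
    and balance: "\<And>j z. \<lbrakk>j \<in> {0..p}; z \<in> space (\<Pi>\<^sub>M i\<in>{0..p}. M)\<rbrakk>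
      \<Longrightarrow> g (z 0) * ennreal (\<alpha> j z) = g (z j) * ennreal (\<alpha> j (swap_first j z))"
    and P: "mp_kernel M p \<alpha> swap_first (proposal_kernel M p Q Qbar) \<in> M \<rightarrow>\<^sub>M prob_algebra M"
      (is "?P \<in> _")
  shows "detailed_balance \<mu> ?P"
proof -
  let ?V = "proposal_kernel M p Q Qbar"
  have V: "?V \<in> M \<rightarrow>\<^sub>M prob_algebra (\<Pi>\<^sub>M i\<in>{1..p}. M)"
    by (rule proposal_kernel_markov[OF Q Qbar])
  have T: "swap_first j \<in> (\<Pi>\<^sub>M i\<in>{0..p}. M) \<rightarrow>\<^sub>M (\<Pi>\<^sub>M i\<in>{0..p}. M)" if "j \<in> {0..p}" for j
    using that by (intro measurable_swap_first) simp_all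
  note [measurable] = g
  have sp: "space m = space M" using m by (rule sets_eq_imp_space_eq)
  have s\<mu>: "sets \<mu> = sets M" by (simp add: \<mu> m)
  have "prob_algebra \<mu> = prob_algebra M"
    unfolding prob_algebra_def by (simp add: subprob_algebra_cong[OF s\<mu>])
  then have P\<mu>: "?P \<in> \<mu> \<rightarrow>\<^sub>M prob_algebra \<mu>"
    using P s\<mu> by (simp cong: measurable_cong_sets)
  have smm: "sets (\<mu> \<Otimes>\<^sub>M \<mu>) = sets (M \<Otimes>\<^sub>M M)" by (intro sets_pair_measure_cong s\<mu>)
  \<comment> \<open>The contribution to \<open>A\<close> of a move from \<open>z 0\<close> to
    \<open>z j\<close>: density at the start, times acceptance weight, times the test that the move
    lies in \<open>A\<close>.\<close>
  define F where "F = (\<lambda>A j z. g (z 0) * ennreal (\<alpha> j z) * indicator A (z 0, z j) :: ennreal)"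
  have F_meas: "F A j \<in> borel_measurable (\<Pi>\<^sub>M i\<in>{0..p}. M)"
    if [measurable]: "A \<in> sets (M \<Otimes>\<^sub>M M)" and j: "j \<in> {0..p}" for A j
  proof -
    note [measurable] = \<alpha>[OF j]
    have [measurable]: "(\<lambda>z. z i) \<in> (\<Pi>\<^sub>M i\<in>{0..p}. M) \<rightarrow>\<^sub>M M" if "i \<in> {0..p}" for i
      using that by (rule measurable_component_singleton)
    from j show ?thesis unfolding F_def by measurable
  qed
  \<comment> \<open>For each \<open>A\<close>, the joint mass is rewritten under the mixture. It is
    used twice below, for a set and for its reversal.\<close>
  have flow: "(\<integral>\<^sup>+x. \<integral>\<^sup>+y. indicator A (x, y) \<partial>?P x \<partial>\<mu>)
      = (\<Sum>j=0..p. \<integral>\<^sup>+q. \<integral>\<^sup>+z. F A j z \<partial>(\<Pi>\<^sub>M i\<in>{0..p}. Q q) \<partial>m)"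
    if A: "A \<in> sets (M \<Otimes>\<^sub>M M)" for A
  proof -
    have sec: "(\<integral>\<^sup>+y. indicator A (x, y) \<partial>?P x)
        = (\<Sum>j=0..p. \<integral>\<^sup>+v. ennreal (\<alpha> j (v(0 := x))) * indicator A (x, (v(0 := x)) j) \<partial>?V x)"
      if x: "x \<in> space M" for x
    proof -
      \<comment> \<open>For fixed \<open>x\<close> the inner integral is the kernel's mass of the
        section of \<open>A\<close> at \<open>x\<close>.\<close>
      have Ax: "Pair x -` A \<in> sets M" by (rule sets_Pair1[OF A])
      have ind: "indicator A (x, y) = (indicator (Pair x -` A) y :: ennreal)" for y
        by (simp add: indicator_def)
      have "(\<integral>\<^sup>+y. indicator A (x, y) \<partial>?P x) = emeasure (?P x) (Pair x -` A)"
        unfolding ind using Ax by (intro nn_integral_indicator) (simp add: sets_mp_kernel)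
      also have "\<dots> = (\<Sum>j=0..p. \<integral>\<^sup>+v. ennreal (\<alpha> j (v(0 := x)))
          * indicator (Pair x -` A) (proj_first (swap_first j (v(0 := x)))) \<partial>?V x)"
        by (rule emeasure_mp_kernel[OF V T \<alpha> x Ax])
      finally show ?thesis by (simp only: proj_swap_first ind)
    qed
    have meas: "(\<lambda>x. \<integral>\<^sup>+y. indicator A (x, y) \<partial>?P x) \<in> borel_measurable M"
      using A by (intro nn_integral_measurable_subprob_algebra2[OF _ measurable_prob_algebraD[OF P]]) simp
    have F_int: "(\<lambda>x. \<integral>\<^sup>+v. F A j (v(0 := x)) \<partial>?V x) \<in> borel_measurable m"
      if j: "j \<in> {0..p}" for j
      using measurable_compose[OF measurable_fun_upd_0 F_meas[OF A j]] m
      by (subst measurable_cong_sets[OF m refl],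
          intro nn_integral_measurable_subprob_algebra2[OF _ measurable_prob_algebraD[OF V]])
        (simp add: case_prod_unfold)
    \<comment> \<open>The density at the start is constant in \<open>v\<close>, so it moves under
      the integral and completes \<open>F\<close>.\<close>
    have sec_F: "g x * (\<integral>\<^sup>+v. ennreal (\<alpha> j (v(0 := x))) * indicator A (x, (v(0 := x)) j) \<partial>?V x)
        = (\<integral>\<^sup>+v. F A j (v(0 := x)) \<partial>?V x)" if x: "x \<in> space M" and j: "j \<in> {0..p}" for x j
    proof -
      have "(\<lambda>z. ennreal (\<alpha> j z) * indicator (Pair x -` A) (proj_first (swap_first j z)))
          \<in> borel_measurable (\<Pi>\<^sub>M i\<in>{0..p}. M)"
        using sets_Pair1[OF A] by (intro borel_measurable_mp_integrand[OF V T \<alpha> j]) simp_all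
      from measurable_section_V[OF V T \<alpha> x this]
      have "(\<lambda>v. ennreal (\<alpha> j (v(0 := x))) * indicator A (x, (v(0 := x)) j)) \<in> borel_measurable (?V x)"
        by (simp add: proj_swap_first indicator_def del: fun_upd_apply)
      then show ?thesis
        by (subst nn_integral_cmult[symmetric]) (auto intro!: nn_integral_cong simp: F_def mult.assoc)
    qed
    have "(\<integral>\<^sup>+x. \<integral>\<^sup>+y. indicator A (x, y) \<partial>?P x \<partial>\<mu>)
        = (\<integral>\<^sup>+x. g x * (\<integral>\<^sup>+y. indicator A (x, y) \<partial>?P x) \<partial>m)"
      unfolding \<mu> using meas g by (intro nn_integral_density) (simp_all add: m cong: measurable_cong_sets)
    also have "\<dots> = (\<integral>\<^sup>+x. (\<Sum>j=0..p. \<integral>\<^sup>+v. F A j (v(0 := x)) \<partial>?V x) \<partial>m)"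
      by (intro nn_integral_cong) (simp only: sp sec sum_distrib_left sec_F cong: sum.cong)
    also have "\<dots> = (\<Sum>j=0..p. \<integral>\<^sup>+x. \<integral>\<^sup>+v. F A j (v(0 := x)) \<partial>?V x \<partial>m)"
      by (intro nn_integral_sum F_int)
    also have "\<dots> = (\<Sum>j=0..p. \<integral>\<^sup>+q. \<integral>\<^sup>+z. F A j z \<partial>(\<Pi>\<^sub>M i\<in>{0..p}. Q q) \<partial>m)"
      by (intro sum.cong refl nn_integral_proposal_kernel[OF Q Qbar m dual] F_meas[OF A])
    finally show ?thesis .
  qed
  have "emeasure (joint \<mu> ?P) A = emeasure (joint_swapped \<mu> ?P) A" if A: "A \<in> sets (M \<Otimes>\<^sub>M M)" for A
  proof -
    \<comment> \<open>The reversal of \<open>A\<close>: a move lies in \<open>B\<close> exactly when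
      the opposite move lies in \<open>A\<close>.\<close>
    define B where "B = (\<lambda>(x, y). (y, x)) -` A \<inter> space (M \<Otimes>\<^sub>M M)"
    have B: "B \<in> sets (M \<Otimes>\<^sub>M M)"
      unfolding B_def by (rule measurable_sets[OF measurable_pair_swap' A])
    have swap: "(\<integral>\<^sup>+z. F A j z \<partial>(\<Pi>\<^sub>M i\<in>{0..p}. Q q)) = (\<integral>\<^sup>+z. F B j z \<partial>(\<Pi>\<^sub>M i\<in>{0..p}. Q q))"
      if q: "q \<in> space m" and j: "j \<in> {0..p}" for q j
    proof -
      have pq: "prob_space (Q q)" "sets (Q q) = sets M"
        using measurable_space[OF Q] q by (auto simp: sp space_prob_algebra)
      have sPi: "sets (\<Pi>\<^sub>M i\<in>{0..p}. Q q) = sets (\<Pi>\<^sub>M i\<in>{0..p}. M)"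
        by (intro sets_PiM_cong refl pq)
      \<comment> \<open>Exchangeability for each fixed \<open>q\<close>; after this only a pointwise
        comparison of integrands remains.\<close>
      have "(\<integral>\<^sup>+z. F A j z \<partial>(\<Pi>\<^sub>M i\<in>{0..p}. Q q)) = (\<integral>\<^sup>+z. F A j (swap_first j z) \<partial>(\<Pi>\<^sub>M i\<in>{0..p}. Q q))"
        using F_meas[OF A j] j sPi pq
        by (intro nn_integral_PiM_swap_first[symmetric]) (simp_all cong: measurable_cong_sets)
      also have "\<dots> = (\<integral>\<^sup>+z. F B j z \<partial>(\<Pi>\<^sub>M i\<in>{0..p}. Q q))"
      proof (rule nn_integral_cong)
        fix z assume "z \<in> space (\<Pi>\<^sub>M i\<in>{0..p}. Q q)"
        then have z: "z \<in> space (\<Pi>\<^sub>M i\<in>{0..p}. M)" by (simp add: sets_eq_imp_space_eq[OF sPi])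
        then have "z 0 \<in> space M" "z j \<in> space M" using j by (auto simp: space_PiM)
        then have "indicator A (z j, z 0) = (indicator B (z 0, z j) :: ennreal)"
          by (simp add: B_def indicator_def space_pair_measure)
        moreover have sw: "swap_first j z 0 = z j" "swap_first j z j = z 0"
          by (simp_all add: swap_first_def)
        ultimately show "F A j (swap_first j z) = F B j z"
          using balance[OF j z] by (simp add: F_def sw)
      qed
      finally show ?thesis .
    qed
    have "emeasure (joint \<mu> ?P) A = (\<integral>\<^sup>+x. \<integral>\<^sup>+y. indicator A (x, y) \<partial>?P x \<partial>\<mu>)"
      using A by (intro emeasure_joint P\<mu>) (simp add: smm)
    also have "\<dots> = (\<Sum>j=0..p. \<integral>\<^sup>+q. \<integral>\<^sup>+z. F B j z \<partial>(\<Pi>\<^sub>M i\<in>{0..p}. Q q) \<partial>m)"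
      unfolding flow[OF A] by (intro sum.cong refl nn_integral_cong swap)
    also have "\<dots> = (\<integral>\<^sup>+x. \<integral>\<^sup>+y. indicator B (x, y) \<partial>?P x \<partial>\<mu>)" by (rule flow[OF B, symmetric])
    \<comment> \<open>Unfolding the reversal gives the mass of \<open>A\<close> with the variables
      exchanged, which is the swapped joint measure.\<close>
    also have "\<dots> = (\<integral>\<^sup>+x. \<integral>\<^sup>+y. indicator A (y, x) \<partial>?P x \<partial>\<mu>)"
    proof (intro nn_integral_cong)
      fix x y assume "x \<in> space \<mu>" "y \<in> space (?P x)"
      then have "x \<in> space M" "y \<in> space M"
        by (simp_all add: sets_eq_imp_space_eq[OF s\<mu>] sets_eq_imp_space_eq[OF sets_mp_kernel])
      then show "indicator B (x, y) = (indicator A (y, x) :: ennreal)"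
        by (simp add: B_def indicator_def space_pair_measure)
    qed
    also have "\<dots> = emeasure (joint_swapped \<mu> ?P) A"
      using A by (intro emeasure_joint_swapped[symmetric] P\<mu>) (simp add: smm)
    finally show ?thesis .
  qed
  then show ?thesis
    unfolding detailed_balance_def by (intro measure_eqI) (simp_all add: joint_swapped_def smm)
qed

section \<open>The two acceptance rules\<close>

lemma borel_measurable_alpha_a:
  assumes [measurable]: "r \<in> borel_measurable M" and j: "j \<in> {0..p}"
  shows "alpha_a p r j \<in> borel_measurable (\<Pi>\<^sub>M i\<in>{0..p}. M)"
proof -
  have [measurable]: "(\<lambda>z. r (z i)) \<in> borel_measurable (\<Pi>\<^sub>M i\<in>{0..p}. M)" if "i \<in> {0..p}" for i
    using that by (intro measurable_compose[OF measurable_component_singleton]) simp_all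
  from j show ?thesis unfolding alpha_a_def by measurable
qed

lemma borel_measurable_alpha_b:
  assumes [measurable]: "r \<in> borel_measurable M" and j: "j \<in> {0..p}"
  shows "alpha_b p w r j \<in> borel_measurable (\<Pi>\<^sub>M i\<in>{0..p}. M)"
proof -
  have [measurable]: "(\<lambda>z. r (z i)) \<in> borel_measurable (\<Pi>\<^sub>M i\<in>{0..p}. M)" if "i \<in> {0..p}" for i
    using that by (intro measurable_compose[OF measurable_component_singleton]) simp_all
  have [measurable]: "(\<lambda>z. w i * min 1 (r (z i) / r (z 0))) \<in> borel_measurable (\<Pi>\<^sub>M i\<in>{0..p}. M)"
    if "i \<in> {0..p}" for i
    using that by measurable
  have "(\<lambda>z. \<Sum>i=1..p. w i * min 1 (r (z i) / r (z 0))) \<in> borel_measurable (\<Pi>\<^sub>M i\<in>{0..p}. M)"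
    by (rule borel_measurable_sum) simp
  with j show ?thesis unfolding alpha_b_def by (cases "j = 0") simp_all
qed

text \<open>The denominator is a sum over all coordinates and hence invariant under the
  transposition. Both sides equal \<open>r (z 0) * r (z j)\<close> divided by it.\<close>

lemma alpha_a_swap_first:
  assumes j: "j \<in> {0..p}"
  shows "r (z j) * alpha_a p r j (swap_first j z) = r (z 0) * alpha_a p r j z"
proof -
  have "(\<Sum>k=0..p. r (swap_first j z k)) = (\<Sum>k=0..p. r (z (Transposition.transpose 0 j k)))"
    by (intro sum.cong refl) (simp add: swap_first_def Transposition.transpose_def)
  also have "\<dots> = (\<Sum>k=0..p. r (z k))"
    using j by (intro sum.reindex_bij_witness[where i = "Transposition.transpose 0 j"
          and j = "Transposition.transpose 0 j"]) (auto simp: Transposition.transpose_def)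
  finally show ?thesis by (simp add: alpha_a_def) (simp add: swap_first_def)
qed

text \<open>The Metropolis symmetry: for positive \<open>x\<close>, the product of \<open>x\<close>
  with \<open>min 1 (y / x)\<close> is \<open>min x y\<close>, which is symmetric. For
  \<open>j = 0\<close> the swap is the identity.\<close>

lemma alpha_b_swap_first:
  assumes "0 < r (z 0)" "0 < r (z j)"
  shows "r (z j) * alpha_b p w r j (swap_first j z) = r (z 0) * alpha_b p w r j z"
proof (cases "j = 0")
  case False
  have "x * min 1 (y / x) = min x y" if "0 < x" for x y :: real
    using that by (auto simp: min_def field_simps)
  then have "r (z j) * min 1 (r (z 0) / r (z j)) = r (z 0) * min 1 (r (z j) / r (z 0))"
    using assms by (metis min.commute)
  with False show ?thesis by (simp add: alpha_b_def swap_first_def)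
qed (simp add: swap_first_0)

text \<open>Only the remainder weight at \<open>j = 0\<close> is in doubt. Each minimum is at most
  1, so the subtracted sum is at most the sum of the \<open>w i\<close>.\<close>

lemma alpha_b_nonneg:
  assumes w: "\<And>i. i \<in> {1..p} \<Longrightarrow> 0 \<le> w i" "(\<Sum>i=1..p. w i) \<le> 1"
    and r: "\<And>i. i \<in> {0..p} \<Longrightarrow> 0 < r (z i)" and j: "j \<in> {0..p}"
  shows "0 \<le> alpha_b p w r j z"
proof (cases "j = 0")
  case True
  have "(\<Sum>i=1..p. w i * min 1 (r (z i) / r (z 0))) \<le> (\<Sum>i=1..p. w i)"
    using w by (intro sum_mono mult_left_le) auto
  with w True show ?thesis by (simp add: alpha_b_def)
next
  case False
  with w(1)[of j] r[of 0] r[OF j] j show ?thesis by (simp add: alpha_b_def)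
qed

lemma sum_alpha_a:
  assumes "\<And>i. i \<in> {0..p} \<Longrightarrow> 0 < r (z i)"
  shows "(\<Sum>j=0..p. alpha_a p r j z) = 1"
proof -
  \<comment> \<open>Positivity excludes a zero denominator, for which every quotient would default
    to 0.\<close>
  have "0 < (\<Sum>k=0..p. r (z k))" using assms by (intro sum_pos) auto
  then show ?thesis by (simp add: alpha_a_def flip: sum_divide_distrib)
qed

text \<open>The weight at index 0 is by definition what the others leave over from 1.\<close>

lemma sum_alpha_b: "(\<Sum>j=0..p. alpha_b p w r j z) = 1"
  by (simp add: sum.atLeast_Suc_atMost alpha_b_def)

section \<open>Detailed balance for both acceptance rules\<close>

theorem corollary2p12:
  fixes M \<mu> \<mu>0 :: "'a measure"
    and p :: nat
    and Q Qbar :: "'a \<Rightarrow> 'a measure"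
    and r :: "'a \<Rightarrow> real"
    and \<alpha> :: "nat \<Rightarrow> (nat \<Rightarrow> 'a) \<Rightarrow> real"
  assumes "p \<ge> 1"
    and "prob_space \<mu>" and "sets \<mu> = sets M"
    and "Q \<in> M \<rightarrow>\<^sub>M prob_algebra M" and "Qbar \<in> M \<rightarrow>\<^sub>M prob_algebra M"
    and "sigma_finite_measure \<mu>0" and "sets \<mu>0 = sets M"
    and "absolutely_continuous \<mu>0 \<mu>"
    and "AE q in \<mu>0. RN_deriv \<mu>0 \<mu> q > 0"
    and "joint \<mu>0 Q = joint_swapped \<mu>0 Qbar"
    and "r \<in> borel_measurable M"
    and "AE q in \<mu>0. ennreal (r q) = RN_deriv \<mu>0 \<mu> q"
    and "\<forall>q\<in>space M. r q > 0"
    and "\<alpha> = alpha_a p r \<or>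
         (\<exists>w. (\<forall>j\<in>{1..p}. w j \<ge> 0) \<and> (\<Sum>j=1..p. w j) \<le> 1 \<and> \<alpha> = alpha_b p w r)"
  shows "mp_kernel M p \<alpha> swap_first (proposal_kernel M p Q Qbar) \<in> M \<rightarrow>\<^sub>M prob_algebra M
    \<and> detailed_balance \<mu> (mp_kernel M p \<alpha> swap_first (proposal_kernel M p Q Qbar))"
proof -
  let ?I = "\<Pi>\<^sub>M i\<in>{0..p}. M" and ?P = "mp_kernel M p \<alpha> swap_first (proposal_kernel M p Q Qbar)"
  have r_pos: "0 < r (z i)" if "z \<in> space ?I" "i \<in> {0..p}" for z i
    using that assms(13) by (auto simp: space_PiM)
  have meas: "\<alpha> j \<in> borel_measurable ?I" if "j \<in> {0..p}" for j
    using assms(14) borel_measurable_alpha_a[OF assms(11) that] borel_measurable_alpha_b[OF assms(11) that]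
    by auto
  have balance: "r (z j) * \<alpha> j (swap_first j z) = r (z 0) * \<alpha> j z"
    if "j \<in> {0..p}" "z \<in> space ?I" for j z
    using assms(14) alpha_a_swap_first[OF that(1)] alpha_b_swap_first[of r z j] r_pos[OF that(2)] that(1) by auto
  have nonneg: "0 \<le> \<alpha> j z" if j: "j \<in> {0..p}" and z: "z \<in> space ?I" for j z
    using assms(14)
  proof (elim disjE exE conjE)
    assume "\<alpha> = alpha_a p r"
    then show ?thesis
      using r_pos[OF z] j by (auto simp: alpha_a_def less_imp_le intro!: divide_nonneg_nonneg sum_nonneg)
  next
    fix w assume "\<forall>j\<in>{1..p}. w j \<ge> 0" "(\<Sum>j=1..p. w j) \<le> 1" "\<alpha> = alpha_b p w r"
    then show ?thesis using alpha_b_nonneg[of p w r z j] r_pos[OF z] j by simp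
  qed
  have sum_1: "(\<Sum>j=0..p. \<alpha> j z) = 1" if "z \<in> space ?I" for z
    using assms(14) sum_alpha_a[of p r z] r_pos[OF that] sum_alpha_b by auto
  have swap: "swap_first j \<in> ?I \<rightarrow>\<^sub>M ?I" if "j \<in> {0..p}" for j
    using that by (intro measurable_swap_first) simp_all
  have P: "?P \<in> M \<rightarrow>\<^sub>M prob_algebra M"
    by (rule mp_kernel_markov[OF proposal_kernel_markov[OF assms(4,5)] swap meas nonneg sum_1])
  \<comment> \<open>\<open>r\<close> agrees almost everywhere with the Radon-Nikodym derivative, so
    it is a density of \<open>\<mu>\<close>; absolute continuity and \<sigma>-finiteness make that
    derivative reproduce \<open>\<mu>\<close>.\<close>
  have "density \<mu>0 (\<lambda>q. ennreal (r q)) = density \<mu>0 (RN_deriv \<mu>0 \<mu>)"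
    using assms(7,11,12) by (intro density_cong) (simp_all cong: measurable_cong_sets)
  also have "\<dots> = \<mu>"
    by (rule sigma_finite_measure.density_RN_deriv) (simp_all add: assms)
  finally have "\<mu> = density \<mu>0 (\<lambda>q. ennreal (r q))" ..
  \<comment> \<open>The real identity transfers to \<open>ennreal\<close> because all four factors
    are nonnegative; for the last one this uses that \<open>swap_first j z\<close> stays in the
    product space.\<close>
  moreover have "ennreal (r (z 0)) * ennreal (\<alpha> j z) = ennreal (r (z j)) * ennreal (\<alpha> j (swap_first j z))"
    if "j \<in> {0..p}" "z \<in> space ?I" for j z
    using balance[OF that] nonneg[OF that(1)] that r_pos[OF that(2)] measurable_space[OF swap]
    by (simp add: less_imp_le flip: ennreal_mult)
  ultimately have "detailed_balance \<mu> ?P"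
    using measurable_compose[OF assms(11) measurable_ennreal]
    by (intro detailed_balance_mp_kernel[OF assms(4,5,7,10) _ _ meas _ P]) simp_all
  with P show ?thesis by simp
qed

end
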